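(* For $n\ge 0$, let $a_n=-1$ when $n=2^j$ for some integer $j\ge 0$, and let $a_n=1$ otherwise. Write \[ F(x)=\sum_{n\ge 0}a_nx^n,\qquad F(x)^4=\sum_{n\ge 0}c(n)x^n . \] Then the sequence $(a_n)_{n\ge 0}$ is $2$-automatic, every $c(n)$ ($n\ge 0$) is nonzero, and the sequence $(\omega(n))_{n\ge 0}$ of residues \[ \omega(n)=\operatorname{odd}(c(n)) \pmod 4 \] is not $2$-automatic.
   Context: For a nonzero integer $a$, $\nu_2(a)$ is the largest integer $v$ such that $2^v$ divides $a$, and the signed odd part is $\operatorname{odd}(a)=a/2^{\nu_2(a)}$; also $\operatorname{odd}(0)=0$. A sequence $(a_n)_{n\ge 0}$ with values in a finite set is $2$-automatic if there is a finite automaton which, reading the binary expansion of $n$ from the most significant digit, outputs $a_n$; equivalently, its $2$-kernel $\{(a_{2^e n+c})_{n\ge 0}: e\ge 0,\ 0\le c<2^e\}$ is finite. *)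

theory Defs
  imports "HOL-Computational_Algebra.Computational_Algebra"
begin

(* Most significant digit first, without leading zeros, True standing for the digit 1;
   the expansion of 0 is the empty word. *)
fun binary_expansion :: "nat \<Rightarrow> bool list" where
  "binary_expansion n = (if n = 0 then [] else binary_expansion (n div 2) @ [odd n])"

declare binary_expansion.simps [simp del]

(* Taking the states to be natural numbers loses nothing, since a finite set of states can be
   renamed. Finiteness of Q forces the sequence to take only finitely many values. *)
definition two_automatic :: "(nat \<Rightarrow> 'a) \<Rightarrow> bool" where
  "two_automatic a \<longleftrightarrow>
     (\<exists>(Q :: nat set) (q0 :: nat) (\<delta> :: nat \<Rightarrow> bool \<Rightarrow> nat) (\<tau> :: nat \<Rightarrow> 'a).
        finite Q \<and> q0 \<in> Q \<and> (\<forall>q\<in>Q. \<forall>d. \<delta> q d \<in> Q) \<and>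
        (\<forall>n. a n = \<tau> (foldl \<delta> q0 (binary_expansion n))))"

definition signed_odd_part :: "int \<Rightarrow> int" where
  "signed_odd_part a = (if a = 0 then 0 else a div 2 ^ multiplicity 2 a)"

definition a_seq :: "nat \<Rightarrow> int" where
  "a_seq n = (if \<exists>j::nat. n = 2 ^ j then - 1 else 1)"

definition F_series :: "int fps" where
  "F_series = Abs_fps a_seq"

definition c_coeff :: "nat \<Rightarrow> int" where
  "c_coeff n = fps_nth (F_series ^ 4) n"

(* The residue class modulo 4 is given by its representative in {0, 1, 2, 3}. *)
definition omega :: "nat \<Rightarrow> int" where
  "omega n = signed_odd_part (c_coeff n) mod 4"

end

(* Let G = 1/(1-x) and g = sum_j x^(2^j), so that F = G - 2g. Expanding the fourth power,
   and dropping the terms 8 G g^2 (3G - 4g) and 16 g^4, whose coefficients are nonnegative,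
   shows that c(n) is at least [x^n](G^4 - 8 G^3 g), which is positive for n >= 256;
   the smaller n are checked by computation.

   At n = 2^k - 3 every coefficient of the expansion is explicit, and 3 c(n) is congruent to
   8 p(k) modulo 2^(k-1), where p is a cubic with p(k + h) - p(k) = h * (odd number). Hence p
   is onto modulo every power of 2. If omega were automatic, then k |-> omega(2^k - 3) would be
   eventually periodic, because the expansions of these n are 1...101. Let 2^s be the exact
   power of 2 in a period T and choose a large k with p(k) = 2^s mod 2^(s+2). Then
   p(k + 2T) = 3 * 2^s mod 2^(s+2), so that the odd parts at k and k + 2T differ modulo 4. *)

theory Submission
  imports Defs
begin

subsection \<open>Expansion of the fourth power\<close>

definition ones_fps :: "int fps" where
  "ones_fps = Abs_fps (\<lambda>_. 1)"

definition pow2_fps :: "int fps" where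
  "pow2_fps = Abs_fps (\<lambda>n. of_bool (\<exists>j::nat. n = 2 ^ j))"

lemma ones_fps_mult_nth: "fps_nth (ones_fps * h) n = (\<Sum>i\<le>n. fps_nth h i)"
  unfolding mult.commute[of ones_fps] by (simp add: fps_mult_nth ones_fps_def atMost_atLeast0)

lemma ones_fps_mult_Suc: "fps_nth (ones_fps * h) (Suc n) = fps_nth (ones_fps * h) n + fps_nth h (Suc n)"
  by (simp add: ones_fps_mult_nth)

lemma ones_fps_power_nth:
  shows ones_fps_power1_nth: "fps_nth ones_fps n = 1"
    and ones_fps_power2_nth: "fps_nth (ones_fps ^ 2) n = int n + 1"
    and ones_fps_power3_nth: "2 * fps_nth (ones_fps ^ 3) n = (int n + 1) * (int n + 2)"
    and ones_fps_power4_nth: "6 * fps_nth (ones_fps ^ 4) n = (int n + 1) * (int n + 2) * (int n + 3)"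
proof -
  have p2: "fps_nth (ones_fps ^ 2) n = int n + 1" for n
    by (simp add: power2_eq_square ones_fps_mult_nth) (simp add: ones_fps_def)
  have p3: "2 * fps_nth (ones_fps ^ 3) n = (int n + 1) * (int n + 2)" for n
  proof (induction n)
    case 0
    then show ?case by (simp add: power3_eq_cube ones_fps_mult_nth ones_fps_def)
  next
    case (Suc n)
    have "ones_fps ^ 3 = ones_fps * ones_fps ^ 2" by (simp add: eval_nat_numeral)
    with Suc show ?case by (simp add: ones_fps_mult_Suc p2 algebra_simps)
  qed
  have p4: "6 * fps_nth (ones_fps ^ 4) n = (int n + 1) * (int n + 2) * (int n + 3)" for n
  proof (induction n)
    case 0
    then show ?case by (simp add: power4_eq_xxxx ones_fps_mult_nth ones_fps_def mult.assoc)
  next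
    case (Suc n)
    have "ones_fps ^ 4 = ones_fps * ones_fps ^ 3" by (simp add: eval_nat_numeral)
    with Suc p3[of "Suc n"] show ?case by (simp add: ones_fps_mult_Suc algebra_simps)
  qed
  show "fps_nth ones_fps n = 1" "fps_nth (ones_fps ^ 2) n = int n + 1"
    "2 * fps_nth (ones_fps ^ 3) n = (int n + 1) * (int n + 2)"
    "6 * fps_nth (ones_fps ^ 4) n = (int n + 1) * (int n + 2) * (int n + 3)"
    using p2 p3 p4 by (auto simp: ones_fps_def)
qed

text \<open>Sums over exponents instead of indices. Any \<open>k\<close> with n < 2^k is allowed, so
  nested products with \<open>pow2_fps\<close> can share one range of exponents; the
  \<open>if\<close> guards against truncated subtraction.\<close>

lemma pow2_fps_mult_nth:
  assumes "n < 2 ^ k"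
  shows "fps_nth (pow2_fps * h) n = (\<Sum>j<k. if 2 ^ j \<le> n then fps_nth h (n - 2 ^ j) else 0)"
proof -
  let ?J = "{j \<in> {..<k}. 2 ^ j \<le> n}"
  have "fps_nth (pow2_fps * h) n = (\<Sum>i\<in>(\<lambda>j. 2 ^ j) ` ?J. fps_nth h (n - i))"
    unfolding fps_mult_nth
  proof (rule sum.mono_neutral_cong_right)
    show "\<forall>i\<in>{0..n} - (\<lambda>j. 2 ^ j) ` ?J. fps_nth pow2_fps i * fps_nth h (n - i) = 0"
    proof
      fix i assume i: "i \<in> {0..n} - (\<lambda>j. 2 ^ j) ` ?J"
      have "i \<noteq> 2 ^ j" for j
      proof
        assume "i = 2 ^ j"
        with i have "2 ^ j \<le> n" by simp
        then have "(2::nat) ^ j < 2 ^ k" using assms by (rule le_less_trans)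
        then have "j < k" by simp
        with i \<open>i = 2 ^ j\<close> show False by auto
      qed
      then show "fps_nth pow2_fps i * fps_nth h (n - i) = 0" by (simp add: pow2_fps_def)
    qed
  qed (auto simp: pow2_fps_def)
  also have "\<dots> = (\<Sum>j\<in>?J. fps_nth h (n - 2 ^ j))"
    by (subst sum.reindex) (auto intro!: inj_onI)
  also have "\<dots> = (\<Sum>j<k. if 2 ^ j \<le> n then fps_nth h (n - 2 ^ j) else 0)"
    by (rule sum.inter_filter) simp
  finally show ?thesis .
qed

text \<open>The binomial expansion of (G - 2g)^4, with the factors g on the left so that
  \<open>pow2_fps_mult_nth\<close> can unfold them one at a time.\<close>

lemma c_coeff_eq:
  "c_coeff n = fps_nth (ones_fps ^ 4) n - 8 * fps_nth (pow2_fps * ones_fps ^ 3) n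
     + 24 * fps_nth (pow2_fps * (pow2_fps * ones_fps ^ 2)) n
     - 32 * fps_nth (pow2_fps * (pow2_fps * (pow2_fps * ones_fps))) n
     + 16 * fps_nth (pow2_fps ^ 4) n"
proof -
  have F: "F_series = ones_fps - 2 * pow2_fps"
    by (rule fps_ext) (simp add: F_series_def a_seq_def ones_fps_def pow2_fps_def numeral_fps_const)
  have expand: "(x - 2 * y) ^ 4 = x ^ 4 - 8 * (y * x ^ 3) + 24 * (y * (y * x ^ 2))
      - 32 * (y * (y * (y * x))) + 16 * y ^ 4" for x y :: "int fps"
    by (simp add: power2_eq_square power3_eq_cube power4_eq_xxxx algebra_simps)
  have "F_series ^ 4 = ones_fps ^ 4 - 8 * (pow2_fps * ones_fps ^ 3)
      + 24 * (pow2_fps * (pow2_fps * ones_fps ^ 2))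
      - 32 * (pow2_fps * (pow2_fps * (pow2_fps * ones_fps))) + 16 * pow2_fps ^ 4"
    unfolding F by (rule expand)
  then show ?thesis
    by (simp add: c_coeff_def numeral_fps_const)
qed

subsection \<open>Nonvanishing\<close>

lemma pow2_sum_le:
  assumes "n < 2 ^ k"
  shows "(\<Sum>i\<le>n. fps_nth pow2_fps i) \<le> int k"
proof -
  have "(\<Sum>i\<le>n. fps_nth pow2_fps i) = fps_nth (pow2_fps * ones_fps) n"
    by (simp add: ones_fps_mult_nth mult.commute)
  also have "\<dots> \<le> (\<Sum>j<k. 1)"
    unfolding pow2_fps_mult_nth[OF assms] by (rule sum_mono) (simp add: ones_fps_power_nth)
  finally show ?thesis by simp
qed

text \<open>For 2^k <= n < 2^(k+1) at most k + 1 powers of two are counted, so the inequality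
  reduces to its worst case n = 2^k.\<close>

lemma four_pow2_sum_le: "4 * (\<Sum>i\<le>n. fps_nth pow2_fps i) \<le> 3 * (int n + 1)"
proof (cases "n = 0")
  case False
  then obtain k where k: "2 ^ k \<le> n" "n < 2 ^ Suc k"
    using ex_power_ivl1[of 2 n] by auto
  have "4 * (int k + 1) \<le> 3 * (2 ^ k + 1)"
  proof (cases "k = 0")
    case False
    then have "Suc 0 \<le> k" by simp
    then show ?thesis by (induction k rule: dec_induct) auto
  qed simp
  moreover have "2 ^ k \<le> int n" using k(1) by (metis of_nat_le_iff of_nat_numeral of_nat_power)
  ultimately have "4 * (int k + 1) \<le> 3 * (int n + 1)" by (smt (verit))
  with pow2_sum_le[OF k(2)] show ?thesis by simp
qed (simp add: pow2_fps_def)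

lemma fps_mult_nth_nonneg:
  fixes f h :: "int fps"
  assumes "\<And>n. fps_nth f n \<ge> 0" "\<And>n. fps_nth h n \<ge> 0"
  shows "fps_nth (f * h) n \<ge> 0"
  unfolding fps_mult_nth by (intro sum_nonneg mult_nonneg_nonneg assms)

text \<open>The two middle terms combine to 8 g^2 (3G^2 - 4Gg). One factor G stays inside the
  bracket: 3G - 4g has coefficient -1 at powers of two, whereas its partial sums are
  nonnegative.\<close>

lemma c_coeff_ge: "c_coeff n \<ge> fps_nth (ones_fps ^ 4) n - 8 * fps_nth (pow2_fps * ones_fps ^ 3) n"
proof -
  have g: "fps_nth pow2_fps n \<ge> 0" for n by (simp add: pow2_fps_def)
  have "fps_nth (3 * (ones_fps * ones_fps) - 4 * (ones_fps * pow2_fps)) n \<ge> 0" for n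
    using four_pow2_sum_le[of n]
    by (simp add: numeral_fps_const ones_fps_mult_nth[of pow2_fps] ones_fps_power_nth
        flip: power2_eq_square)
  then have "fps_nth (pow2_fps * (pow2_fps * (3 * (ones_fps * ones_fps) - 4 * (ones_fps * pow2_fps)))) n \<ge> 0"
    by (intro fps_mult_nth_nonneg g)
  also have "pow2_fps * (pow2_fps * (3 * (ones_fps * ones_fps) - 4 * (ones_fps * pow2_fps)))
      = 3 * (pow2_fps * (pow2_fps * ones_fps ^ 2)) - 4 * (pow2_fps * (pow2_fps * (pow2_fps * ones_fps)))"
    by (simp add: algebra_simps power2_eq_square)
  moreover have "fps_nth (pow2_fps ^ 4) n \<ge> 0"
    unfolding power4_eq_xxxx by (intro fps_mult_nth_nonneg g)
  ultimately show ?thesis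
    by (simp add: c_coeff_eq numeral_fps_const)
qed

text \<open>At most k + 1 powers of two contribute to g G^3, each at most n(n+1)/2, while the
  coefficient of G^4 exceeds n^2 (n+1)/6. Hence 24(k+1) <= n suffices.\<close>

lemma c_coeff_pos:
  assumes "n \<ge> 256"
  shows "c_coeff n > 0"
proof -
  obtain k where k: "2 ^ k \<le> n" "n < 2 ^ Suc k"
    using ex_power_ivl1[of 2 n] assms by auto
  have "(2::nat) ^ 8 < 2 ^ Suc k" using assms k(2) by simp
  then have "8 \<le> k" by (subst (asm) power_strict_increasing_iff) auto
  \<comment> \<open>The least such exponent is k = 8, where 216 <= 256; this fixes the threshold
    256.\<close>
  then have "24 * (int k + 1) \<le> 2 ^ k"
    by (induction k rule: dec_induct) auto
  moreover have "2 ^ k \<le> int n" using k(1) by (metis of_nat_le_iff of_nat_numeral of_nat_power)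
  ultimately have kn: "24 * (int k + 1) \<le> int n" by linarith
  have "2 * fps_nth (pow2_fps * ones_fps ^ 3) n
      = (\<Sum>j<Suc k. if 2 ^ j \<le> n then 2 * fps_nth (ones_fps ^ 3) (n - 2 ^ j) else 0)"
    unfolding pow2_fps_mult_nth[OF k(2)] sum_distrib_left by (rule sum.cong) auto
  also have "\<dots> \<le> (\<Sum>j<Suc k. int n * (int n + 1))"
  proof (rule sum_mono)
    fix j
    have "(int (n - 2 ^ j) + 1) * (int (n - 2 ^ j) + 2) \<le> int n * (int n + 1)" if "2 ^ j \<le> n"
    proof -
      have "n - 2 ^ j + 1 \<le> n" using diff_less[of "2 ^ j" n] assms by (simp add: Suc_le_eq)
      then show ?thesis by (intro mult_mono) linarith+
    qed
    then show "(if 2 ^ j \<le> n then 2 * fps_nth (ones_fps ^ 3) (n - 2 ^ j) else 0) \<le> int n * (int n + 1)"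
      by (simp add: ones_fps_power_nth)
  qed
  also have "\<dots> = (int k + 1) * (int n * (int n + 1))" by simp
  finally have "48 * fps_nth (pow2_fps * ones_fps ^ 3) n \<le> 24 * ((int k + 1) * (int n * (int n + 1)))"
    by linarith
  also have "\<dots> = (24 * (int k + 1)) * (int n * (int n + 1))"
    by (rule mult.assoc[symmetric])
  also have "\<dots> \<le> int n * (int n * (int n + 1))"
    using kn by (intro mult_right_mono) auto
  also have "\<dots> < (int n + 1) * (int n + 2) * (int n + 3)"
    by (simp add: algebra_simps add_pos_nonneg)
  also have "\<dots> = 6 * fps_nth (ones_fps ^ 4) n" by (simp add: ones_fps_power_nth)
  finally show ?thesis using c_coeff_ge[of n] by linarith
qed

section \<open>Evaluation of the coefficients below 256 by list convolution\<close>

fun dot_list :: "int list \<Rightarrow> int list \<Rightarrow> int" where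
  "dot_list (x # xs) (y # ys) = x * y + dot_list xs ys"
| "dot_list _ _ = 0"

(* The first argument holds the part of the first sequence already read, in reverse order. *)
fun conv_list :: "int list \<Rightarrow> int list \<Rightarrow> int list \<Rightarrow> int list" where
  "conv_list r [] ys = []"
| "conv_list r (x # xs) ys = dot_list (x # r) ys # conv_list (x # r) xs ys"

lemma dot_list_eq_sum:
  "length xs \<le> length ys \<Longrightarrow> dot_list xs ys = (\<Sum>i<length xs. xs ! i * ys ! i)"
  by (induction xs ys rule: dot_list.induct) (auto simp: sum.lessThan_Suc_shift simp del: sum.lessThan_Suc)

text \<open>The reversed prefix of f, paired with h from its beginning, gives one coefficient of the
  Cauchy product. The split point \<open>m\<close> is general for the induction on the number of
  unread entries; the applications take m = 0.\<close>

lemma conv_list_fps: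
  "m \<le> N \<Longrightarrow> conv_list (rev (map (fps_nth f) [0..<m])) (map (fps_nth f) [m..<N]) (map (fps_nth h) [0..<N])
     = map (fps_nth (f * h)) [m..<N]"
proof (induction "N - m" arbitrary: m)
  case 0
  then show ?case by simp
next
  case (Suc d)
  then have "m < N" by simp
  have "dot_list (rev (map (fps_nth f) [0..<Suc m])) (map (fps_nth h) [0..<N])
      = (\<Sum>i<Suc m. fps_nth f (m - i) * fps_nth h i)"
    using \<open>m < N\<close> by (subst dot_list_eq_sum) (auto simp: rev_nth simp del: upt_Suc intro!: sum.cong)
  also have "\<dots> = fps_nth (f * h) m"
    unfolding mult.commute[of f h] fps_mult_nth
    by (auto simp: atMost_atLeast0 lessThan_Suc_atMost mult.commute intro!: sum.cong)
  finally have "dot_list (fps_nth f m # rev (map (fps_nth f) [0..<m])) (map (fps_nth h) [0..<N]) = fps_nth (f * h) m"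
    by simp
  then show ?case
    using Suc.hyps(1)[of "Suc m"] Suc.hyps(2) \<open>m < N\<close> by (simp add: upt_conv_Cons)
qed

text \<open>Cutting at the powers of two turns the initial segment into an explicit list, so that
  evaluation does not have to decide the existential quantifier in \<open>a_seq\<close>.\<close>

lemma map_a_seq:
  "map a_seq [0..<2 ^ m] = 1 # concat (map (\<lambda>j. - 1 # replicate (2 ^ j - 1) 1) [0..<m])"
proof (induction m)
  case 0
  then show ?case by (simp add: a_seq_def)
next
  case (Suc m)
  have a1: "a_seq n = 1" if "n \<in> {Suc (2 ^ m)..<2 ^ Suc m}" for n
  proof -
    have "n \<noteq> 2 ^ j" for j
    proof
      assume n: "n = 2 ^ j"
      have "2 ^ m < n" "n < 2 ^ Suc m" using that by auto
      then have "m < j" "j < Suc m" unfolding n by (simp_all del: power_Suc)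
      then show False by simp
    qed
    then show ?thesis by (simp add: a_seq_def)
  qed
  have "map a_seq [Suc (2 ^ m)..<2 ^ Suc m] = map (\<lambda>_. 1) [Suc (2 ^ m)..<2 ^ Suc m]"
    using a1 by (intro map_cong) (auto simp del: power_Suc)
  also have "\<dots> = replicate (2 ^ m - 1) 1"
    by (simp add: map_replicate_const)
  finally have "map a_seq [2 ^ m..<2 ^ Suc m] = - 1 # replicate (2 ^ m - 1) 1"
    by (subst upt_conv_Cons) (auto simp: a_seq_def)
  moreover have "[0..<2 ^ Suc m] = [0..<2 ^ m] @ [2 ^ m..<2 ^ Suc m]"
    using upt_add_eq_append[of 0 "2 ^ m" "2 ^ m"] by (simp add: mult_2)
  ultimately show ?case using Suc by (simp del: power_Suc)
qed

text \<open>\<open>A\<close> lists the first 256 coefficients of F, \<open>B\<close> those of F^2,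
  and convolving \<open>B\<close> with itself gives those of F^4.\<close>

lemma c_coeff_small_list:
  "list_all (\<lambda>x. x \<noteq> 0)
     (let A = 1 # concat (map (\<lambda>j. - 1 # replicate (2 ^ j - 1) 1) [0..<8]);
          B = conv_list [] A A
      in conv_list [] B B)"
  by code_simp

lemma c_coeff_nonzero: "c_coeff n \<noteq> 0"
proof (cases "n < 256")
  case True
  let ?A = "map (fps_nth F_series) [0..<256]" and ?B = "map (fps_nth (F_series * F_series)) [0..<256]"
  have A: "?A = 1 # concat (map (\<lambda>j. - 1 # replicate (2 ^ j - 1) 1) [0..<8])"
    using map_a_seq[of 8] by (simp add: F_series_def Abs_fps_inverse del: upt_rec_numeral)
  have B: "?B = conv_list [] ?A ?A"
    using conv_list_fps[of 0 256 F_series F_series] by (simp del: upt_rec_numeral)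
  have "conv_list [] ?B ?B = map c_coeff [0..<256]"
    using conv_list_fps[of 0 256 "F_series * F_series" "F_series * F_series"]
    by (simp add: c_coeff_def[abs_def] power4_eq_xxxx mult.assoc del: upt_rec_numeral)
  then have "list_all (\<lambda>x. x \<noteq> 0) (map c_coeff [0..<256])"
    using c_coeff_small_list unfolding Let_def A[symmetric] B[symmetric] by simp
  with True show ?thesis by (simp add: list_all_iff del: upt_rec_numeral)
next
  case False
  then show ?thesis using c_coeff_pos[of n] by simp
qed

subsection \<open>The coefficients at $2^k - 3$\<close>

fun binary_weight :: "nat \<Rightarrow> nat" where
  "binary_weight n = (if n = 0 then 0 else n mod 2 + binary_weight (n div 2))"

declare binary_weight.simps [simp del]

lemma binary_weight_0 [simp]: "binary_weight 0 = 0"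
  by (simp add: binary_weight.simps)

lemma binary_weight_double [simp]: "binary_weight (2 * n) = binary_weight n"
  by (cases "n = 0") (simp_all add: binary_weight.simps[of "2 * n"])

lemma binary_weight_Suc_double [simp]: "binary_weight (Suc (2 * n)) = Suc (binary_weight n)"
  by (simp add: binary_weight.simps[of "Suc (2 * n)"])

lemma binary_weight_pow2 [simp]: "binary_weight (2 ^ j) = 1"
  by (induction j) (use binary_weight_Suc_double[of 0] in simp_all)

lemma binary_weight_Suc: "binary_weight (Suc n) \<le> Suc (binary_weight n)"
proof (induction n rule: less_induct)
  case (less n)
  show ?case
  proof (cases "even n")
    case True
    then show ?thesis by (auto elim!: evenE)
  next
    case False
    then obtain q where n: "n = Suc (2 * q)" by (auto elim!: oddE)
    have "binary_weight (Suc n) = binary_weight (Suc q)"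
      using binary_weight_double[of "Suc q"] by (simp add: n)
    then show ?thesis using less[of q] by (simp add: n)
  qed
qed

text \<open>Recursion on the last digits. If both are 1, a carry passes to the sum of the quotients,
  and \<open>binary_weight_Suc\<close> bounds its cost by one of the two digits removed.\<close>

lemma binary_weight_add_le: "binary_weight (a + b) \<le> binary_weight a + binary_weight b"
proof (induction a arbitrary: b rule: less_induct)
  case (less a)
  have sum: "binary_weight (2 * p + 2 * q) = binary_weight (p + q)" for p q
    using binary_weight_double[of "p + q"] by (simp add: algebra_simps)
  have sum': "binary_weight (Suc (2 * p + 2 * q)) = Suc (binary_weight (p + q))" for p q
    using binary_weight_Suc_double[of "p + q"] by (simp add: algebra_simps)
  have sum'': "binary_weight (Suc (Suc (2 * p + 2 * q))) = binary_weight (Suc (p + q))" for p q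
    using binary_weight_double[of "Suc (p + q)"] by (simp add: algebra_simps)
  show ?case
  proof (cases "a = 0")
    case False
    define p where "p = a div 2"
    define q where "q = b div 2"
    have "p < a" using False by (simp add: p_def)
    note IH = less[OF this, of q]
    have "a = 2 * p \<or> a = Suc (2 * p)" "b = 2 * q \<or> b = Suc (2 * q)"
      unfolding p_def q_def by presburger+
    then show ?thesis
      using IH binary_weight_Suc[of "p + q"] by (auto simp: sum sum' sum'')
  qed simp
qed

text \<open>By subadditivity, a sum of d powers of two has at most d binary digits 1.\<close>

lemma pow2_fps_power_nth_eq_0: "binary_weight n > d \<Longrightarrow> fps_nth (pow2_fps ^ d) n = 0"
proof (induction d arbitrary: n)
  case 0
  then show ?case by (cases "n = 0") auto
next
  case (Suc d)
  have "fps_nth pow2_fps i * fps_nth (pow2_fps ^ d) (n - i) = 0" if "i \<le> n" for i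
  proof (cases "\<exists>j. i = 2 ^ j")
    case True
    then obtain j where i: "i = 2 ^ j" by blast
    have "binary_weight n \<le> 1 + binary_weight (n - i)"
      using binary_weight_add_le[of i "n - i"] that by (simp add: i)
    then have "fps_nth (pow2_fps ^ d) (n - i) = 0"
      using Suc.prems by (intro Suc.IH) simp
    then show ?thesis by simp
  qed (simp add: pow2_fps_def)
  then show ?case by (auto simp: fps_mult_nth intro!: sum.neutral)
qed

lemma pow2_Suc_minus_1: "(2::nat) ^ Suc k - 1 = Suc (2 * (2 ^ k - 1))"
  by (cases "(2::nat) ^ k") auto

lemma binary_weight_pow2_minus_1: "binary_weight (2 ^ k - 1) = k"
proof (induction k)
  case (Suc k)
  then show ?case unfolding pow2_Suc_minus_1 by simp
qed simp

lemma binary_weight_pow2_minus_3: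
  assumes "k \<ge> 2"
  shows "binary_weight (2 ^ k - 3) = k - 1"
proof -
  obtain q where k: "k = 2 + q" using assms le_Suc_ex by blast
  have "(2::nat) ^ k - 3 = Suc (2 * (2 * (2 ^ q - 1)))"
    unfolding k by (cases "(2::nat) ^ q") (auto simp: power_add)
  then have "binary_weight (2 ^ k - 3) = Suc q"
    by (simp only: binary_weight_Suc_double binary_weight_double binary_weight_pow2_minus_1)
  then show ?thesis by (simp add: k)
qed

lemma sum_pow2: "(\<Sum>j<k. (2::int) ^ j) = 2 ^ k - 1"
  by (induction k) auto

text \<open>With X = 2^k and n = X - 3, the summand is six times the coefficient of G^3 at n - 2^j.
  The factor 3 clears the denominator of the sum of the 4^j.\<close>

lemma sum_ones_fps_power3:
  "(\<Sum>j<m. 3 * (X - 1 - 2 ^ j) * (X - 2 - 2 ^ j))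
     = 3 * int m * (X - 1) * (X - 2) - 3 * (2 * X - 3) * (2 ^ m - 1) + 4 ^ m - 1"
proof (induction m)
  case (Suc m)
  have "(4::int) ^ m = 2 ^ m * 2 ^ m" by (simp flip: power_mult_distrib)
  with Suc show ?case by (simp add: algebra_simps)
qed simp

text \<open>With k = m + 3 and n = 8Y - 3, whether a sum of two or three powers exceeds n depends
  only on which exponents are k - 1 or k - 2; the split makes these comparisons linear in Y.\<close>

lemma pow2_top_cases:
  assumes "j < m + 3" and "(Y :: nat) = 2 ^ m"
  obtains "j = m + 2" "2 ^ j = 4 * Y"
  | "j = m + 1" "2 ^ j = 2 * Y"
  | "j \<le> m" "2 ^ j \<le> Y" "j \<noteq> m + 1" "j \<noteq> m + 2"
proof -
  consider "j = m + 2" | "j = m + 1" | "j \<le> m" using assms by linarith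
  then show thesis using that assms(2) by cases auto
qed

section \<open>Exact coefficients of the mixed terms at n = 2^k - 3\<close>

context
  fixes m Y k n :: nat and X :: int
  assumes m: "m \<ge> 2" and Y_def: "Y = 2 ^ m" and k_def: "k = m + 3" and n_def: "n = 2 ^ k - 3" and X_def: "X = 2 ^ k"
begin

text \<open>The largest sum of three powers that has to stay below n is 4Y + 2Y + Y. It is at most
  8Y - 3 exactly when Y >= 3, which is why m >= 2 is required.\<close>

lemma Y_ge: "Y \<ge> 4"
  using power_increasing[OF m, of "2::nat"] by (simp add: Y_def)

lemma n_eq: "n = 8 * Y - 3"
  by (simp add: Y_def n_def k_def power_add)

lemma n_less: "n < 2 ^ k"
  by (simp add: n_def)

lemma X_eq: "X = 8 * int Y"
  by (simp add: Y_def X_def k_def power_add)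

lemma int_n: "int n = X - 3"
  using Y_ge by (simp add: n_eq X_eq of_nat_diff)

lemma pow2_le_n: "j < k \<Longrightarrow> 2 ^ j \<le> n"
  using Y_ge unfolding k_def n_eq by (elim pow2_top_cases[OF _ Y_def]) linarith+

lemma pow2_ones3: "6 * fps_nth (pow2_fps * ones_fps ^ 3) n
   = 3 * int k * (X - 1) * (X - 2) - 3 * (2 * X - 3) * (X - 1) + X ^ 2 - 1"
proof -
  have "6 * fps_nth (pow2_fps * ones_fps ^ 3) n
      = (\<Sum>j<k. 3 * (2 * fps_nth (ones_fps ^ 3) (n - 2 ^ j)))"
    unfolding pow2_fps_mult_nth[OF n_less] sum_distrib_left
    by (rule sum.cong) (auto simp: pow2_le_n)
  also have "\<dots> = (\<Sum>j<k. 3 * (X - 1 - 2 ^ j) * (X - 2 - 2 ^ j))"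
    by (rule sum.cong) (auto simp: ones_fps_power_nth of_nat_diff pow2_le_n int_n algebra_simps)
  also have "\<dots> = 3 * int k * (X - 1) * (X - 2) - 3 * (2 * X - 3) * (X - 1) + X ^ 2 - 1"
  proof -
    have "(4::int) ^ k = X ^ 2" unfolding X_def by (simp add: power2_eq_square flip: power_mult_distrib)
    then show ?thesis unfolding sum_ones_fps_power3 by (simp add: X_def)
  qed
  finally show ?thesis .
qed

lemma pow2_pow2_mult_nth:
  "fps_nth (pow2_fps * (pow2_fps * h)) n
     = (\<Sum>i<k. \<Sum>j<k. if 2 ^ i + 2 ^ j \<le> n then fps_nth h (n - 2 ^ i - 2 ^ j) else 0)"
proof -
  have "fps_nth (pow2_fps * h) (n - 2 ^ i)
      = (\<Sum>j<k. if 2 ^ i + 2 ^ j \<le> n then fps_nth h (n - 2 ^ i - 2 ^ j) else 0)" if "i < k" for i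
    using n_less pow2_le_n[OF that]
    by (subst pow2_fps_mult_nth[of _ k]) (auto intro!: sum.cong)
  then show ?thesis
    unfolding pow2_fps_mult_nth[OF n_less] by (auto simp: pow2_le_n intro!: sum.cong)
qed

lemma pow2_pow2_ones2: "fps_nth (pow2_fps * (pow2_fps * ones_fps ^ 2)) n
   = int k ^ 2 * (X - 2) - 2 * int k * (X - 1) + 2"
proof -
  \<comment> \<open>Only i = j = k - 1 gives a sum exceeding n. There the linear formula yields -2
    instead of 0, hence the correction 2.\<close>
  have summand: "(if 2 ^ i + 2 ^ j \<le> n then fps_nth (ones_fps ^ 2) (n - 2 ^ i - 2 ^ j) else 0)
      = (X - 2 - 2 ^ i - 2 ^ j) + (if i = m + 2 then if j = m + 2 then 2 else 0 else 0)"
    (is "?l = ?r") if "i < k" "j < k" for i j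
  proof (cases "i = m + 2 \<and> j = m + 2")
    case True
    then show ?thesis using Y_ge by (simp add: n_eq X_eq Y_def)
  next
    case False
    have "2 ^ i + 2 ^ j \<le> n"
      using that False Y_ge unfolding k_def n_eq
      by (elim pow2_top_cases[OF _ Y_def]) auto
    then show ?thesis using False by (auto simp: ones_fps_power_nth of_nat_diff int_n)
  qed
  have "fps_nth (pow2_fps * (pow2_fps * ones_fps ^ 2)) n
      = (\<Sum>i<k. \<Sum>j<k. (X - 2 - 2 ^ i - 2 ^ j) + (if i = m + 2 then if j = m + 2 then 2 else 0 else 0))"
    unfolding pow2_pow2_mult_nth using summand by (intro sum.cong refl) auto
  also have "\<dots> = (\<Sum>i<k. \<Sum>j<k. X - 2 - 2 ^ i - 2 ^ j) + 2"
    by (simp add: sum.distrib k_def if_distrib[of "sum _"] sum.If_cases)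
  also have "\<dots> = int k ^ 2 * (X - 2) - 2 * int k * (X - 1) + 2"
    by (simp add: sum.distrib sum_subtractf sum_pow2 flip: sum_distrib_left sum_distrib_right)
      (simp add: X_def algebra_simps power2_eq_square)
  finally show ?thesis .
qed

lemma pow2_pow2_pow2_ones: "fps_nth (pow2_fps * (pow2_fps * (pow2_fps * ones_fps))) n
   = int k ^ 3 - 3 * int k - 1"
proof -
  define D E where "D i = (if i = m + 2 then 1 else 0 :: int)"
    and "E i = (if i = m + 1 then 1 else 0 :: int)" for i
  have sum_DE: "(\<Sum>i<k. D i) = 1" "(\<Sum>i<k. E i) = 1"
    by (simp_all add: D_def E_def k_def)
  \<comment> \<open>The explicit factors 1 in \<open>?bad\<close> bring its monomials to this
    product shape, so that the triple sums factor.\<close>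
  have sum3: "(\<Sum>i<k. \<Sum>j<k. \<Sum>l<k. f i * g j * h l) = sum f {..<k} * sum g {..<k} * sum h {..<k}"
    for f g h :: "nat \<Rightarrow> int"
    unfolding sum_product[of f "{..<k}" g] unfolding sum_distrib_right unfolding sum_distrib_left ..
  (* Inclusion-exclusion: a triple has 2^i + 2^j + 2^l > n exactly if two exponents are k - 1,
     or one is k - 1 and the other two are k - 2. *)
  let ?bad = "\<lambda>i j l. D i * D j * 1 + D i * 1 * D l + 1 * D j * D l - 2 * D i * D j * D l
    + D i * E j * E l + E i * D j * E l + E i * E j * D l"
  have summand: "(if 2 ^ i + 2 ^ j + 2 ^ l \<le> n then 1 else 0) = 1 - ?bad i j l"
    if "i < k" "j < k" "l < k" for i j l
    using that Y_ge unfolding k_def n_eq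
    by (elim pow2_top_cases[of i, OF _ Y_def] pow2_top_cases[of j, OF _ Y_def] pow2_top_cases[of l, OF _ Y_def]) (auto simp: D_def E_def)
  have "fps_nth (pow2_fps * (pow2_fps * (pow2_fps * ones_fps))) n
      = (\<Sum>i<k. \<Sum>j<k. if 2 ^ i + 2 ^ j \<le> n then
           \<Sum>l<k. if 2 ^ l \<le> n - 2 ^ i - 2 ^ j then 1 else 0 else 0)"
    unfolding pow2_pow2_mult_nth using n_less
    by (intro sum.cong refl if_cong) (subst pow2_fps_mult_nth[of _ k], auto simp: ones_fps_power_nth intro!: sum.cong)
  also have "\<dots> = (\<Sum>i<k. \<Sum>j<k. \<Sum>l<k. if 2 ^ i + 2 ^ j + 2 ^ l \<le> n then 1 else 0)"
    by (intro sum.cong refl) (auto intro!: sum.cong sum.neutral)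
  also have "\<dots> = (\<Sum>i<k. \<Sum>j<k. \<Sum>l<k. 1 - ?bad i j l)"
    using summand by (intro sum.cong refl) auto
  \<comment> \<open>There are 3k - 2 triples with two exponents k - 1, the triple with all three
    being counted once, and 3 arrangements of k - 1, k - 2, k - 2.\<close>
  also have "\<dots> = int k ^ 3 - 3 * int k - 1"
    unfolding sum.distrib sum_subtractf sum3
    by (simp add: sum_DE power3_eq_cube flip: sum_distrib_left)
  finally show ?thesis .
qed

end

text \<open>Putting X = 0 in the closed forms, with k kept as an independent variable, turns the
  expansion of 18 c(2^k - 3) into 48 p(k).\<close>

definition p_poly :: "int \<Rightarrow> int" where
  "p_poly k = 35 + 51 * k - 18 * k ^ 2 - 12 * k ^ 3"

lemma c_coeff_pow2_minus_3:
  assumes "k \<ge> 6"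
  obtains w where "3 * c_coeff (2 ^ k - 3) = 8 * p_poly (int k) + 2 ^ (k - 1) * w"
proof -
  define n m Y where "n = (2::nat) ^ k - 3" and "m = k - 3" and "Y = (2::nat) ^ (k - 3)"
  define X W :: int where "X = 2 ^ k" and "W = 2 ^ (k - 1)"
  have m: "m \<ge> 2" "k = m + 3" using assms by (auto simp: m_def)
  have Y: "Y = 2 ^ m" by (simp add: Y_def m_def)
  note facts = m(1) Y m(2) n_def X_def
  \<comment> \<open>The part of the closed forms divisible by X, divided by 6W after substituting X
    = 2W.\<close>
  define w where "w = 2 * (2 * W - 1) * (W - 1)
      - 8 * (3 * int k * (X - 3) - 3 * (2 * X - 5) + X) + 144 * (int k ^ 2 - 2 * int k)"
  have XW: "X = 2 * W" using m by (simp add: X_def W_def power_add)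
  have o4: "6 * fps_nth (ones_fps ^ 4) n = (X - 2) * (X - 1) * X"
    unfolding ones_fps_power_nth by (simp add: int_n[OF facts])
  have "binary_weight n = k - 1"
    using binary_weight_pow2_minus_3[of k] assms by (simp add: n_def)
  \<comment> \<open>Here k >= 6 enters: the weight k - 1 is greater than 4.\<close>
  then have g4: "fps_nth (pow2_fps ^ 4) n = 0"
    using assms by (intro pow2_fps_power_nth_eq_0) simp
  have "18 * c_coeff n = 3 * (6 * fps_nth (ones_fps ^ 4) n)
      - 24 * (6 * fps_nth (pow2_fps * ones_fps ^ 3) n)
      + 432 * fps_nth (pow2_fps * (pow2_fps * ones_fps ^ 2)) n
      - 576 * fps_nth (pow2_fps * (pow2_fps * (pow2_fps * ones_fps))) n"
    by (simp add: c_coeff_eq g4)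
  also have "\<dots> = 6 * (8 * p_poly (int k) + W * w)"
    unfolding o4 pow2_ones3[OF facts] pow2_pow2_ones2[OF facts] pow2_pow2_pow2_ones[OF facts] XW p_poly_def w_def
    by algebra
  finally have "3 * c_coeff n = 8 * p_poly (int k) + W * w" by simp
  then show thesis unfolding W_def n_def by (rule that)
qed

subsection \<open>Automaticity\<close>

lemma binary_expansion_0 [simp]: "binary_expansion 0 = []"
  by (simp add: binary_expansion.simps)

lemma binary_expansion_double: "n > 0 \<Longrightarrow> binary_expansion (2 * n) = binary_expansion n @ [False]"
  by (simp add: binary_expansion.simps[of "2 * n"])

lemma binary_expansion_Suc_double: "binary_expansion (Suc (2 * n)) = binary_expansion n @ [True]"
  by (simp add: binary_expansion.simps[of "Suc (2 * n)"])

lemma double_eq_pow2_iff: "(\<exists>j::nat. 2 * n = 2 ^ j) \<longleftrightarrow> (\<exists>j::nat. n = 2 ^ j)" for n :: nat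
proof
  assume "\<exists>j::nat. 2 * n = 2 ^ j"
  then obtain j where j: "2 * n = 2 ^ j" by blast
  then show "\<exists>j::nat. n = 2 ^ j" by (cases j) auto
next
  assume "\<exists>j::nat. n = 2 ^ j"
  then show "\<exists>j::nat. 2 * n = 2 ^ j" by (metis power_Suc)
qed

lemma Suc_double_eq_pow2_iff: "(\<exists>j::nat. Suc (2 * n) = 2 ^ j) \<longleftrightarrow> n = 0"
proof
  assume "\<exists>j::nat. Suc (2 * n) = 2 ^ j"
  then obtain j where j: "Suc (2 * n) = 2 ^ j" by blast
  have "j = 0"
  proof (rule ccontr)
    assume "j \<noteq> 0"
    then have "even ((2::nat) ^ j)" by simp
    then show False using j by (metis even_Suc dvd_triv_left)
  qed
  with j show "n = 0" by simp
qed (auto intro: exI[of _ 0])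

lemma two_automatic_a_seq: "two_automatic a_seq"
proof -
  \<comment> \<open>The state counts the digits 1 read so far, capped at 2; powers of two end in
    state 1.\<close>
  define \<delta> :: "nat \<Rightarrow> bool \<Rightarrow> nat" where
    "\<delta> q d = (if q = 0 then of_bool d else if q = 1 then 1 + of_bool d else 2)" for q d
  have state: "foldl \<delta> 0 (binary_expansion n)
      = (if n = 0 then 0 else if \<exists>j::nat. n = 2 ^ j then 1 else 2)" for n
  proof (induction n rule: less_induct)
    case (less n)
    define q where "q = n div 2"
    have "n = 0 \<or> q > 0 \<and> n = 2 * q \<or> n = Suc (2 * q)" unfolding q_def by presburger
    then consider "n = 0" | "q > 0" "n = 2 * q" | "n = Suc (2 * q)" by blast
    then show ?case
    proof cases
      case 2
      then show ?thesis using less[of q]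
        by (simp add: binary_expansion_double double_eq_pow2_iff \<delta>_def)
    next
      case 3
      then show ?thesis using less[of q]
        by (simp add: binary_expansion_Suc_double Suc_double_eq_pow2_iff \<delta>_def)
    qed simp
  qed
  show ?thesis unfolding two_automatic_def
  proof (intro exI conjI allI ballI)
    show "finite {0, 1, 2 :: nat}" "0 \<in> {0, 1, 2 :: nat}" by simp_all
    show "\<delta> q d \<in> {0, 1, 2}" for q d by (simp add: \<delta>_def)
    show "a_seq n = (\<lambda>q. if q = 1 then - 1 else 1) (foldl \<delta> 0 (binary_expansion n))" for n
      unfolding state by (auto simp: a_seq_def)
  qed
qed

lemma binary_expansion_pow2_minus_1: "binary_expansion (2 ^ k - 1) = replicate k True"
proof (induction k)
  case (Suc k)
  then show ?case unfolding pow2_Suc_minus_1 by (simp add: binary_expansion_Suc_double replicate_append_same)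
qed simp

text \<open>The case j = 0 is excluded because 2^2 - 3 = 1 has no leading zero in its
  expansion.\<close>

lemma binary_expansion_pow2_minus_3:
  assumes "j > 0"
  shows "binary_expansion (2 ^ (j + 2) - 3) = replicate j True @ [False, True]"
proof -
  have "(2::nat) ^ (j + 2) - 3 = Suc (2 * (2 * (2 ^ j - 1)))"
    by (cases "(2::nat) ^ j") (auto simp: power_add)
  moreover have "(2::nat) ^ j - 1 > 0" using assms one_less_power[of "2::nat" j] by simp
  ultimately show ?thesis
    by (simp only: binary_expansion_Suc_double binary_expansion_double binary_expansion_pow2_minus_1) simp
qed

lemma foldl_replicate: "foldl \<delta> q (replicate j d) = ((\<lambda>q. \<delta> q d) ^^ j) q"
  by (induction j) (simp_all flip: replicate_append_same)

text \<open>On the leading ones the automaton iterates a single map of a finite set, so its state is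
  eventually periodic by the pigeonhole principle; the suffix 01 is the same for all k.\<close>

lemma two_automatic_pow2_minus_3_periodic:
  assumes "two_automatic a"
  shows "\<exists>T>0. \<exists>N. \<forall>k\<ge>N. a (2 ^ (k + T) - 3) = a (2 ^ k - 3)"
proof -
  obtain Q :: "nat set" and q0 \<delta> \<tau> where Q: "finite Q" "q0 \<in> Q" "\<And>q d. q \<in> Q \<Longrightarrow> \<delta> q d \<in> Q"
    and a: "\<And>n. a n = \<tau> (foldl \<delta> q0 (binary_expansion n))"
    using assms unfolding two_automatic_def by metis
  define s where "s j = ((\<lambda>q. \<delta> q True) ^^ j) q0" for j
  have "s j \<in> Q" for j by (induction j) (simp_all add: s_def Q)
  then have "finite (range s)" using Q(1) by (auto intro: finite_subset)
  then have "\<not> inj s" using finite_imageD by blast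
  then obtain i i' where "s i = s i'" "i < i'" by (auto simp: inj_def) (metis linorder_neqE_nat)
  define T where "T = i' - i"
  have T: "T > 0" "s (i + T) = s i" using \<open>s i = s i'\<close> \<open>i < i'\<close> by (auto simp: T_def)
  have per: "s (i + d + T) = s (i + d)" for d
    by (induction d) (use T(2) in \<open>simp_all add: s_def\<close>)
  \<comment> \<open>Of the offset 3, two accounts for the suffix 01 and one makes the number of
    leading ones positive even if i = 0.\<close>
  have "a (2 ^ (k + T) - 3) = a (2 ^ k - 3)" if "k \<ge> i + 3" for k
  proof -
    define d where "d = k - (i + 3)"
    have k: "k = i + Suc d + 2" using that by (simp add: d_def)
    have "a (2 ^ (j + 2) - 3) = \<tau> (\<delta> (\<delta> (s j) False) True)" if "j > 0" for j
      unfolding a binary_expansion_pow2_minus_3[OF that] by (simp add: foldl_replicate s_def)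
    from this[of "i + Suc d"] this[of "i + Suc d + T"] show ?thesis
      unfolding per by (simp add: k ac_simps)
  qed
  with T(1) show ?thesis by blast
qed

subsection \<open>Odd parts\<close>

lemma signed_odd_part_pow2_mult:
  assumes "odd u"
  shows "signed_odd_part (2 ^ v * u) = u"
proof -
  have "\<not> 2 ^ Suc v dvd 2 ^ v * u" using assms by (simp add: mult.commute)
  then have "multiplicity 2 (2 ^ v * u) = v" by (intro multiplicity_eqI) simp_all
  then show ?thesis using assms by (auto simp: signed_odd_part_def)
qed

text \<open>The odd factor 3 leaves the power of 2 alone, and 3 is its own inverse modulo 4.\<close>

lemma omega_eqI:
  assumes "3 * c_coeff n = 2 ^ v * u" "odd u"
  shows "omega n = (3 * u) mod 4"
proof -
  have "(2::int) ^ v dvd 3 * c_coeff n" using assms(1) by simp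
  then have "(2::int) ^ v dvd c_coeff n"
    by (subst (asm) coprime_dvd_mult_right_iff) simp_all
  then obtain u' where u': "c_coeff n = 2 ^ v * u'" by (elim dvdE)
  with assms(1) have u: "u = 3 * u'" by simp
  with assms(2) have "odd u'" by simp
  then have "signed_odd_part (c_coeff n) = u'"
    unfolding u' by (rule signed_odd_part_pow2_mult)
  then have "omega n = u' mod 4" by (simp add: omega_def)
  also have "\<dots> = (u' + 4 * (2 * u')) mod 4" by (simp only: mod_mult_self2)
  also have "u' + 4 * (2 * u') = 3 * u" using u by simp
  finally show ?thesis .
qed

text \<open>Among the nonconstant coefficients of p only the linear one, 51, is odd, so the
  difference quotient is odd.\<close>

lemma p_poly_add:
  obtains c where "p_poly (x + h) = p_poly x + h * (1 + 2 * c)"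
proof
  show "p_poly (x + h) = p_poly x + h * (1 + 2 * (25 - 9 * (2 * x + h) - 6 * (3 * x ^ 2 + 3 * x * h + h ^ 2)))"
    unfolding p_poly_def by algebra
qed

text \<open>Lifting as in Hensel's lemma: if the quotient by 2^M is odd, moving k to k + 2^M changes
  p(k) by an odd multiple of 2^M. As k never decreases, the bound N is kept.\<close>

lemma p_poly_surj_mod_pow2: "\<exists>k\<ge>N. 2 ^ M dvd p_poly (int k) - r"
proof (induction M)
  case (Suc M)
  then obtain k where k: "k \<ge> N" "2 ^ M dvd p_poly (int k) - r" by blast
  then obtain d where d: "p_poly (int k) - r = 2 ^ M * d" by (elim dvdE)
  show ?case
  proof (cases "even d")
    case True
    with d k(1) show ?thesis by (intro exI[of _ k]) (auto elim!: evenE)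
  next
    case False
    obtain c where c: "p_poly (int k + 2 ^ M) = p_poly (int k) + 2 ^ M * (1 + 2 * c)"
      by (rule p_poly_add)
    obtain e where e: "d = 2 * e + 1" using False by (elim oddE)
    have "p_poly (int (k + 2 ^ M)) - r = 2 ^ Suc M * (e + 1 + c)"
      using c d e by (simp add: algebra_simps)
    then show ?thesis using k(1) by (intro exI[of _ "k + 2 ^ M"]) simp
  qed
qed auto

text \<open>Since k - 1 >= (s + 3) + 2, the error term is a multiple of 4 * 2^(s+3) and cannot
  affect the odd part modulo 4.\<close>

lemma omega_pow2_minus_3:
  assumes "k \<ge> s + 6" "p_poly (int k) = 2 ^ s * (r + 4 * u)" "odd r"
  shows "omega (2 ^ k - 3) = (3 * r) mod 4"
proof -
  obtain w where w: "3 * c_coeff (2 ^ k - 3) = 8 * p_poly (int k) + 2 ^ (k - 1) * w"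
    using c_coeff_pow2_minus_3[of k] assms(1) by auto
  obtain q where "k = s + 6 + q" using le_Suc_ex[OF assms(1)] by blast
  then have k: "k - 1 = (s + 3) + 2 + q" by simp
  define z where "z = u + 2 ^ q * w"
  have "3 * c_coeff (2 ^ k - 3) = 2 ^ (s + 3) * (r + 4 * z)"
    unfolding w assms(2) k power_add z_def by (simp add: algebra_simps)
  then have "omega (2 ^ k - 3) = (3 * (r + 4 * z)) mod 4"
    using assms(3) by (intro omega_eqI[where v = "s + 3"]) simp_all
  also have "3 * (r + 4 * z) = 3 * r + 4 * (3 * z)" by simp
  also have "\<dots> mod 4 = (3 * r) mod 4" by (simp only: mod_mult_self2)
  finally show ?thesis .
qed

lemma not_two_automatic_omega: "\<not> two_automatic omega"
proof
  assume "two_automatic omega"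
  from two_automatic_pow2_minus_3_periodic[OF this] obtain T N where T: "T > 0"
    and per: "\<forall>k\<ge>N. omega (2 ^ (k + T) - 3) = omega (2 ^ k - 3)"
    by blast
  define s where "s = multiplicity 2 T"
  obtain t where t: "T = 2 ^ s * t" "odd t"
    unfolding s_def by (rule multiplicity_decompose'[of T 2]) (use T in auto)
  obtain k where k: "k \<ge> N + s + 6" "2 ^ (s + 2) dvd p_poly (int k) - 2 ^ s"
    using p_poly_surj_mod_pow2 by blast
  then obtain u where "p_poly (int k) - 2 ^ s = 2 ^ (s + 2) * u" by (elim dvdE)
  then have pk: "p_poly (int k) = 2 ^ s * (1 + 4 * u)" by (simp add: algebra_simps)
  obtain c where c: "p_poly (int k + 2 * int T) = p_poly (int k) + 2 * int T * (1 + 2 * c)"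
    by (rule p_poly_add)
  obtain e where e: "t = 2 * e + 1" using t(2) by (elim oddE)
  \<comment> \<open>A shift by 2T adds 2t(1 + 2c), which is 2 modulo 4, to the odd cofactor. A
    single period would add an odd number and so change the power of 2.\<close>
  have pk': "p_poly (int (k + T + T)) = 2 ^ s * (3 + 4 * (u + int e + int t * c))"
  proof -
    have "int (k + T + T) = int k + 2 * int T" by simp
    then show ?thesis using c pk t(1) e by (simp add: algebra_simps)
  qed
  have "omega (2 ^ (k + T + T) - 3) = omega (2 ^ k - 3)"
    using per k(1) by simp
  moreover have "omega (2 ^ k - 3) = 3"
    using omega_pow2_minus_3[OF _ pk] k(1) by simp
  moreover have "omega (2 ^ (k + T + T) - 3) = 1"
    using omega_pow2_minus_3[OF _ pk'] k(1) by simp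
  ultimately show False by simp
qed

theorem theoremA1:
  shows "two_automatic a_seq \<and> (\<forall>n. c_coeff n \<noteq> 0) \<and> \<not> two_automatic omega"
  by (intro conjI allI two_automatic_a_seq c_coeff_nonzero not_two_automatic_omega)

end
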